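(* Let $q\in\mathbb{C}$ with $|q|<1$. Then the following four identities hold: $$\sum_{n=0}^{\infty} \frac{(-q^2;q^2)_{n}\,q^{n^2}}{(q;q)_{2n+1}} =\frac{(-q;q^2)_{\infty}}{(q;q^2)_{\infty}},$$ $$\sum_{n=0}^{\infty} \frac{(-1;q)_{2n}\,q^{n^2+n}}{(q^2;q^2)_{n}(q^2;q^4)_{n}} =\frac{(-q^3;q^6)_{\infty}^2(q^6;q^6)_{\infty}(-q^2;q^2)_{\infty}}{(q^2;q^2)_{\infty}},$$ $$\sum_{n=0}^{\infty} \frac{(q;q^2)_{2n}\,q^{2n^2+4n}(-1)^n}{(q^8;q^8)_{n}(-q^2;q^4)_{n+1}} = (-q^9,-q^7,q^8;q^8)_{\infty}\frac{(q^2;q^4)_{\infty}}{(q^4;q^4)_{\infty}},$$ $$\sum_{n=0}^{\infty} \frac{(q;q^2)_{2n}\,q^{2n^2}(-1)^n}{(q^8;q^8)_{n}(-q^2;q^4)_{n}} = (-q^3,-q^5,q^8;q^8)_{\infty}\frac{(q^2;q^4)_{\infty}}{(q^4;q^4)_{\infty}}.$$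
   Context: For $|q|<1$, $x\in\mathbb{C}$ and an integer $n\ge 0$: $(x;q)_n=\prod_{j=0}^{n-1}(1-xq^j)$ (so $(x;q)_0=1$), $(x;q)_\infty=\prod_{j=0}^{\infty}(1-xq^j)$, and $(x_1,\dots,x_k;q)_\infty=\prod_{i=1}^k (x_i;q)_\infty$. The same notation is used with base $q^m$ in place of $q$. *)

theory Defs
  imports "HOL-Analysis.Analysis"
begin

definition qpoch :: "complex \<Rightarrow> complex \<Rightarrow> nat \<Rightarrow> complex" where
  "qpoch x q n = (\<Prod>j<n. 1 - x * q ^ j)"

text \<open>
  Meaningful for \<open>norm q < 1\<close>, where the product converges. The library's \<open>has_prod\<close>, which
  underlies \<open>prodinf\<close>, admits vanishing factors (the value is then 0).
\<close>

definition qpoch_inf :: "complex \<Rightarrow> complex \<Rightarrow> complex" where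
  "qpoch_inf x q = (\<Prod>j. 1 - x * q ^ j)"

definition qpoch_inf_list :: "complex list \<Rightarrow> complex \<Rightarrow> complex" where
  "qpoch_inf_list xs q = (\<Prod>x\<leftarrow>xs. qpoch_inf x q)"

end

(* Identity 1 is a limit of the q-Gauss sum, and identities 3 and 4 are instances of Andrews'
   q-analogue of Bailey's 2F1(1/2) sum in base q^4. In both summations, clearing the denominators
   that depend on the argument z makes the series H(z) satisfy a first-order functional equation
   H(z) = k(z) H(z q^i), because the difference of the terms telescopes; iterating it and letting
   z tend to 0 gives the product.

   Identity 2 is Bailey's lemma in base p = q^2: 1/(q;q)_{2n} is expanded as a sum over r of
   pair_coeff q r / ((p;p)_{n-r} (p;p)_{n+r}), the sums are exchanged, the inner sum is evaluated
   by the limiting q-Gauss sum, and the remaining series in r is the theta series of q^3. The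
   expansion, and the finite form of the theta product, are proved by WZ certificates. *)
theory Submission
  imports Defs
begin

subsection \<open>Finite and infinite q-Pochhammer products\<close>

lemma qpoch_0 [simp]: "qpoch x q 0 = 1"
  by (simp add: qpoch_def)

lemma qpoch_Suc: "qpoch x q (Suc n) = qpoch x q n * (1 - x * q ^ n)"
  by (simp add: qpoch_def)

lemma qpoch_Suc_shift: "qpoch x q (Suc n) = (1 - x) * qpoch (x * q) q n"
  by (simp add: qpoch_def prod.lessThan_Suc_shift mult_ac del: prod.lessThan_Suc)

lemma qpoch_add: "qpoch x q (m + n) = qpoch x q m * qpoch (x * q ^ m) q n"
  by (induction n) (simp_all add: qpoch_Suc power_add mult_ac)

lemma qpoch_nonzero:
  assumes "norm q < 1" "norm x < 1"
  shows "qpoch x q n \<noteq> 0"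
proof -
  have "x * q ^ j \<noteq> 1" for j
  proof -
    have "norm (x * q ^ j) \<le> norm x * 1"
      unfolding norm_mult norm_power using assms by (intro mult_left_mono power_le_one) auto
    then show ?thesis using assms by auto
  qed
  then show ?thesis by (simp add: qpoch_def eq_commute[of 1])
qed

section \<open>Convergence, nonvanishing and bounds for the infinite products\<close>

lemma summable_norm_mult_power:
  fixes x q :: complex
  assumes "norm q < 1"
  shows "summable (\<lambda>j. norm (x * q ^ j))"
  using assms by (auto simp: norm_mult norm_power intro!: summable_mult summable_geometric)

lemma convergent_qpoch_inf:
  fixes x q :: complex
  assumes "norm q < 1"
  shows "convergent_prod (\<lambda>j. 1 - x * q ^ j)"
proof -
  have "abs_convergent_prod (\<lambda>j. 1 - x * q ^ j)"
    using summable_norm_mult_power[OF assms, of x]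
    by (intro summable_imp_abs_convergent_prod) (simp add: norm_mult)
  then show ?thesis by (rule abs_convergent_prod_imp_convergent_prod)
qed

lemma qpoch_LIMSEQ:
  assumes "norm q < 1"
  shows "qpoch x q \<longlonglongrightarrow> qpoch_inf x q"
proof -
  have "(\<lambda>n. qpoch x q (Suc n)) \<longlonglongrightarrow> qpoch_inf x q"
    using convergent_prod_LIMSEQ[OF convergent_qpoch_inf[OF assms, of x]]
    by (simp add: qpoch_def qpoch_inf_def lessThan_Suc_atMost del: prod.lessThan_Suc)
  then show ?thesis by (rule LIMSEQ_imp_Suc)
qed

lemma qpoch_inf_nonzero:
  assumes "norm q < 1" "norm x < 1"
  shows "qpoch_inf x q \<noteq> 0"
proof -
  have "1 - x * q ^ j \<noteq> 0" for j
    using qpoch_nonzero[OF assms, of "Suc j"] by (auto simp: qpoch_Suc)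
  then show ?thesis
    unfolding qpoch_inf_def using prodinf_nonzero[OF convergent_qpoch_inf[OF assms(1), of x]] by blast
qed

lemma qpoch_inf_split:
  assumes "norm q < 1"
  shows "qpoch_inf x q = qpoch x q m * qpoch_inf (x * q ^ m) q"
proof -
  have "(\<lambda>n. qpoch x q (n + m)) \<longlonglongrightarrow> qpoch_inf x q"
    by (rule LIMSEQ_ignore_initial_segment[OF qpoch_LIMSEQ[OF assms]])
  moreover have "(\<lambda>n. qpoch x q (n + m)) \<longlonglongrightarrow> qpoch x q m * qpoch_inf (x * q ^ m) q"
    using tendsto_mult_left[OF qpoch_LIMSEQ[OF assms, of "x * q ^ m"], of "qpoch x q m"]
    by (simp add: qpoch_add add.commute[of _ m])
  ultimately show ?thesis by (rule LIMSEQ_unique)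
qed

lemma qpoch_inf_rec:
  assumes "norm q < 1"
  shows "qpoch_inf x q = (1 - x) * qpoch_inf (x * q) q"
  using qpoch_inf_split[OF assms, of x 1] by (simp add: qpoch_def)

lemma qpoch_bounded:
  assumes "norm q < 1"
  obtains C where "C > 0" "\<And>n. norm (qpoch x q n) \<le> C"
  using qpoch_LIMSEQ[OF assms, THEN convergentI, THEN convergent_imp_Bseq, of x]
  by (auto elim!: BseqE)

text \<open>The limit \<open>qpoch_inf x q\<close> is nonzero for |x| < 1, so the inverses converge
  and are therefore bounded. This controls coefficients with denominators such as
  \<open>qpoch q q n\<close> uniformly in n.\<close>

lemma inverse_qpoch_bounded:
  assumes "norm q < 1" "norm x < 1"
  obtains C where "C > 0" "\<And>n. norm (inverse (qpoch x q n)) \<le> C"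
proof -
  have "(\<lambda>n. inverse (qpoch x q n)) \<longlonglongrightarrow> inverse (qpoch_inf x q)"
    by (intro tendsto_inverse qpoch_LIMSEQ qpoch_inf_nonzero assms)
  from convergent_imp_Bseq[OF convergentI[OF this]] show ?thesis
    using that by (auto elim!: BseqE)
qed

text \<open>The finite products satisfy |prod (1 - a_j) - 1| <= prod (1 + |a_j|) - 1 <= exp (sum
  |a_j|) - 1 with a geometric sum, and the bound survives the limit. Being explicit in x, it serves
  both for continuity at 0 and for majorants uniform in the argument.\<close>

lemma norm_qpoch_inf_diff_1_le:
  assumes "norm q < 1"
  shows "norm (qpoch_inf x q - 1) \<le> exp (norm x / (1 - norm q)) - 1"
proof (rule tendsto_upperbound)
  show "(\<lambda>n. norm (qpoch x q n - 1)) \<longlonglongrightarrow> norm (qpoch_inf x q - 1)"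
    by (intro tendsto_intros qpoch_LIMSEQ assms)
  have "norm (qpoch x q n - 1) \<le> exp (norm x / (1 - norm q)) - 1" for n
  proof -
    have "norm (qpoch x q n - 1) \<le> (\<Prod>j<n. 1 + norm (x * q ^ j)) - 1"
      using norm_prod_minus1_le_prod_minus1[of "\<lambda>j. - (x * q ^ j)" "{..<n}"]
      by (simp add: qpoch_def)
    also have "\<dots> \<le> exp (\<Sum>j<n. norm (x * q ^ j)) - 1"
      using prod_le_exp_sum[of "{..<n}" "\<lambda>j. norm (x * q ^ j)"] by simp
    also have "(\<Sum>j<n. norm (x * q ^ j)) \<le> (\<Sum>j. norm (x * q ^ j))"
      by (intro sum_le_suminf summable_norm_mult_power assms) auto
    also have "\<dots> = norm x / (1 - norm q)"
      using assms by (simp add: norm_mult norm_power suminf_mult suminf_geometric)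
    finally show ?thesis by simp
  qed
  then show "\<forall>\<^sub>F n in sequentially. norm (qpoch x q n - 1) \<le> exp (norm x / (1 - norm q)) - 1"
    by simp
qed simp

lemma qpoch_inf_tendsto_1:
  assumes "norm q < 1" "(f \<longlongrightarrow> 0) F"
  shows "((\<lambda>t. qpoch_inf (f t) q) \<longlongrightarrow> 1) F"
proof -
  have "((\<lambda>t. exp (norm (f t) / (1 - norm q)) - 1) \<longlongrightarrow> exp (norm (0::complex) / (1 - norm q)) - 1) F"
    by (intro tendsto_intros assms) (use assms in auto)
  then have "((\<lambda>t. exp (norm (f t) / (1 - norm q)) - 1) \<longlongrightarrow> 0) F" by simp
  then have "((\<lambda>t. qpoch_inf (f t) q - 1) \<longlongrightarrow> 0) F"
    by (rule Lim_null_comparison[rotated])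
       (auto intro!: always_eventually norm_qpoch_inf_diff_1_le assms)
  then show ?thesis by (simp add: LIM_zero_iff)
qed

lemma norm_qpoch_inf_le:
  assumes "norm q < 1"
  shows "norm (qpoch_inf x q) \<le> exp (norm x / (1 - norm q))"
  using norm_qpoch_inf_diff_1_le[OF assms, of x] norm_triangle_ineq2[of "qpoch_inf x q" 1] by simp

section \<open>Change of base: splitting by parity and pairing x with -x\<close>

lemma qpoch_even:
  "qpoch x q (2 * n) = qpoch x (q\<^sup>2) n * qpoch (x * q) (q\<^sup>2) n"
  by (induction n) (simp_all add: qpoch_Suc power_even_eq mult_ac flip: power_mult)

lemma qpoch_mult_neg: "qpoch x q n * qpoch (- x) q n = qpoch (x\<^sup>2) (q\<^sup>2) n"
  by (induction n) (simp_all add: qpoch_Suc power2_eq_square power_mult_distrib algebra_simps)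

lemma norm_power_less_1:
  fixes q :: complex
  assumes "norm q < 1" "n > 0"
  shows "norm (q ^ n) < 1"
  using assms by (simp add: norm_power power_less_one_iff)

lemma qpoch_inf_even:
  assumes "norm q < 1"
  shows "qpoch_inf x q = qpoch_inf x (q\<^sup>2) * qpoch_inf (x * q) (q\<^sup>2)"
proof (rule LIMSEQ_unique)
  show "(\<lambda>n. qpoch x q (2 * n)) \<longlonglongrightarrow> qpoch_inf x q"
    using LIMSEQ_subseq_LIMSEQ[OF qpoch_LIMSEQ[OF assms], of "\<lambda>n. 2 * n" x]
    by (simp add: strict_mono_def o_def)
  have "norm (q\<^sup>2) < 1" by (rule norm_power_less_1[OF assms]) simp
  then show "(\<lambda>n. qpoch x q (2 * n)) \<longlonglongrightarrow> qpoch_inf x (q\<^sup>2) * qpoch_inf (x * q) (q\<^sup>2)"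
    unfolding qpoch_even by (intro tendsto_intros qpoch_LIMSEQ)
qed

lemma qpoch_inf_mult_neg:
  assumes "norm q < 1"
  shows "qpoch_inf x q * qpoch_inf (- x) q = qpoch_inf (x\<^sup>2) (q\<^sup>2)"
proof (rule LIMSEQ_unique)
  show "(\<lambda>n. qpoch x q n * qpoch (- x) q n) \<longlonglongrightarrow> qpoch_inf x q * qpoch_inf (- x) q"
    by (intro tendsto_intros qpoch_LIMSEQ assms)
  have "norm (q\<^sup>2) < 1" by (rule norm_power_less_1[OF assms]) simp
  then show "(\<lambda>n. qpoch x q n * qpoch (- x) q n) \<longlonglongrightarrow> qpoch_inf (x\<^sup>2) (q\<^sup>2)"
    unfolding qpoch_mult_neg by (rule qpoch_LIMSEQ)
qed

subsection \<open>Series summed by a functional equation\<close>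

text \<open>The tail \<open>(d z q\<^sup>n; q)\<^sub>\<infinity>\<close> stands for a denominator \<open>(d z; q)\<^sub>n\<close>, multiplied through by
  \<open>(d z; q)\<^sub>\<infinity>\<close>; thus no \<open>z\<close> has to be excluded in the functional equation.\<close>

definition qser :: "(nat \<Rightarrow> complex) \<Rightarrow> complex \<Rightarrow> complex \<Rightarrow> complex \<Rightarrow> nat \<Rightarrow> complex" where
  "qser c d q z n = c n * q ^ (n choose 2) * z ^ n * qpoch_inf (d * z * q ^ n) q"

section \<open>Majorants, limits and telescoping for the series\<close>

lemma summable_power_choose_2:
  fixes r R :: real
  assumes "0 \<le> r" "r < 1" "0 \<le> R"
  shows "summable (\<lambda>n. r ^ (n choose 2) * R ^ n)"
proof -
  \<comment> \<open>This is the ratio of consecutive terms; it tends to 0 however large R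
    is.\<close>
  have "(\<lambda>n. r ^ n * R) \<longlonglongrightarrow> 0 * R"
    using assms by (intro tendsto_intros LIMSEQ_power_zero) auto
  then have "\<forall>\<^sub>F n in sequentially. r ^ n * R < 1 / 2"
    by (rule order_tendstoD) simp
  then obtain N where N: "r ^ n * R < 1 / 2" if "n \<ge> N" for n
    by (auto simp: eventually_sequentially)
  show ?thesis
  proof (rule summable_ratio_test[of "1 / 2" N])
    fix n assume "n \<ge> N"
    have "(r ^ n * R) * (r ^ (n choose 2) * R ^ n) \<le> 1 / 2 * (r ^ (n choose 2) * R ^ n)"
      using N[OF \<open>n \<ge> N\<close>] assms by (intro mult_right_mono) auto
    moreover have "Suc n choose 2 = n + (n choose 2)"
      using binomial_Suc_Suc[of n 1] by (simp add: numeral_2_eq_2)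
    ultimately show "norm (r ^ (Suc n choose 2) * R ^ Suc n) \<le> 1 / 2 * norm (r ^ (n choose 2) * R ^ n)"
      using assms by (simp add: power_add mult_ac)
  qed simp
qed

text \<open>The majorant depends on z only through R, as Tannery's theorem requires when the
  argument varies.\<close>

lemma qser_bound:
  assumes "norm q < 1" "\<And>n. norm (c n) \<le> C" "norm z \<le> R"
  shows "norm (qser c d q z n)
    \<le> C * exp (norm d * R / (1 - norm q)) * (norm q ^ (n choose 2) * R ^ n)"
proof -
  have C: "C \<ge> 0" using assms(2)[of 0] norm_ge_zero order_trans by blast
  have R: "R \<ge> 0" using assms(3) norm_ge_zero order_trans by blast
  have "norm (d * z * q ^ n) \<le> norm d * R * 1"
    unfolding norm_mult norm_power using assms R by (intro mult_mono power_le_one) auto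
  then have "exp (norm (d * z * q ^ n) / (1 - norm q)) \<le> exp (norm d * R / (1 - norm q))"
    using assms(1) by (simp add: divide_right_mono)
  then have "norm (qpoch_inf (d * z * q ^ n) q) \<le> exp (norm d * R / (1 - norm q))"
    using norm_qpoch_inf_le[OF assms(1)] order_trans by blast
  then have "norm (c n) * norm q ^ (n choose 2) * norm z ^ n * norm (qpoch_inf (d * z * q ^ n) q)
     \<le> C * norm q ^ (n choose 2) * R ^ n * exp (norm d * R / (1 - norm q))"
    using assms C R by (intro mult_mono power_mono) auto
  then show ?thesis by (simp add: qser_def norm_mult norm_power mult_ac)
qed

lemma summable_qser:
  assumes "norm q < 1" "\<And>n. norm (c n) \<le> C"
  shows "summable (qser c d q z)"
  by (rule summable_comparison_test'[OF _ qser_bound[OF assms order_refl]])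
     (intro summable_mult summable_power_choose_2; use assms in simp)

text \<open>By Tannery's theorem: terms with n > 0 die because of \<open>z ^ n\<close>, and the term
  n = 0 tends to \<open>c 0\<close>. This evaluates the factor left over after iterating a
  functional equation.\<close>

lemma suminf_qser_tendsto:
  assumes "norm q < 1" "\<And>n. norm (c n) \<le> C" "c 0 = 1" "w \<longlonglongrightarrow> 0"
  shows "(\<lambda>N. suminf (qser c d q (w N))) \<longlonglongrightarrow> 1"
proof -
  obtain R where R: "\<And>N. norm (w N) \<le> R"
    using convergent_imp_Bseq[OF convergentI[OF assms(4)]] by (metis BseqE)
  have lim: "(\<lambda>N. qser c d q (w N) n) \<longlonglongrightarrow> (if n = 0 then 1 else 0)" for n
  proof (cases "n = 0")
    case True
    have "(\<lambda>N. qpoch_inf (d * w N) q) \<longlonglongrightarrow> 1"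
      by (intro qpoch_inf_tendsto_1 assms tendsto_mult_right_zero)
    then show ?thesis using True by (simp add: qser_def assms(3) binomial_eq_0)
  next
    case False
    have "(\<lambda>N. qpoch_inf (d * w N * q ^ n) q) \<longlonglongrightarrow> 1"
      by (intro qpoch_inf_tendsto_1 assms tendsto_mult_right_zero tendsto_mult_left_zero)
    then have "(\<lambda>N. c n * q ^ (n choose 2) * w N ^ n * qpoch_inf (d * w N * q ^ n) q)
        \<longlonglongrightarrow> c n * q ^ (n choose 2) * 0 ^ n * 1"
      by (intro tendsto_intros assms)
    then show ?thesis using False by (simp add: qser_def power_0_left)
  qed
  have R0: "R \<ge> 0" using R[of 0] norm_ge_zero order_trans by blast
  have "(\<lambda>N. suminf (qser c d q (w N))) \<longlonglongrightarrow> (\<Sum>n. if n = 0 then 1 else 0)"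
    by (rule tannerys_theorem[OF lim, where M = "\<lambda>n. C * exp (norm d * R / (1 - norm q)) * (norm q ^ (n choose 2) * R ^ n)",
          THEN conjunct2, THEN conjunct2])
       (auto intro!: always_eventually qser_bound assms R summable_mult summable_power_choose_2 R0)
  also have "(\<Sum>n. if n = 0 then 1 else 0 :: complex) = 1"
    using suminf_finite[of "{0}" "\<lambda>n. if n = 0 then 1 else 0 :: complex"] by simp
  finally show ?thesis .
qed

text \<open>Both boundary values of the certificate \<open>G\<close> vanish, so the telescoped
  difference sums to 0 and the functional equation has no inhomogeneous term.\<close>

lemma suminf_telescope_eq:
  fixes f g G :: "nat \<Rightarrow> complex"
  assumes "summable f" "summable g" "G \<longlonglongrightarrow> 0" "G 0 = 0"
    and "\<And>n. f n - k * g n = G n - G (Suc n)"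
  shows "suminf f = k * suminf g"
proof -
  have "(\<lambda>n. f n - k * g n) sums (G 0 - 0)"
    unfolding assms(5) by (rule telescope_sums'[OF assms(3)])
  moreover have "(\<lambda>n. f n - k * g n) sums (suminf f - k * suminf g)"
    by (intro sums_diff sums_mult summable_sums assms)
  ultimately show ?thesis using assms(4) by (simp add: sums_iff)
qed

section \<open>Two summation theorems\<close>

lemma norm_mult_le_mult:
  fixes x y :: complex
  assumes "norm x \<le> A" "norm y \<le> B"
  shows "norm (x * y) \<le> A * B"
  unfolding norm_mult
  by (rule mult_mono[OF assms order_trans[OF norm_ge_zero assms(1)] norm_ge_zero])

text \<open>The q-Gauss sum with one numerator parameter sent to infinity. The certificate
  \<open>(1 - q ^ n) * ?U z n\<close> yields H(z) = (1 - z) H(z q), whose iteration builds up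
  \<open>qpoch z q N\<close>.\<close>

lemma suminf_limit_q_gauss:
  assumes q: "norm q < 1"
  shows "summable (qser (\<lambda>n. (-1) ^ n * qpoch a q n / qpoch q q n) a q z)" (is "summable (?U z)")
    and "(\<Sum>n. qser (\<lambda>n. (-1) ^ n * qpoch a q n / qpoch q q n) a q z n) = qpoch_inf z q"
proof -
  let ?c = "\<lambda>n. (-1) ^ n * qpoch a q n / qpoch q q n"
  obtain A where A: "\<And>n. norm (qpoch a q n) \<le> A" using qpoch_bounded[OF q] by metis
  obtain B where B: "\<And>n. norm (inverse (qpoch q q n)) \<le> B" using inverse_qpoch_bounded[OF q q] by metis
  have c: "norm (?c n) \<le> A * B" for n
    using norm_mult_le_mult[OF A[of n] B[of n]] by (simp add: norm_mult norm_divide norm_inverse divide_inverse norm_power)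
  note U = summable_qser[OF q c]
  show "summable (?U z)" by (rule U)
  have nz: "qpoch q q n \<noteq> 0" for n by (rule qpoch_nonzero[OF q q])
  have step: "suminf (?U z) = (1 - z) * suminf (?U (z * q))" for z
  proof (rule suminf_telescope_eq[OF U U, where G = "\<lambda>n. (1 - q ^ n) * ?U z n"])
    have "(\<lambda>n. (1 - q ^ n) * ?U z n) \<longlonglongrightarrow> (1 - 0) * 0"
      by (intro tendsto_intros LIMSEQ_power_zero summable_LIMSEQ_zero[OF U] q)
    then show "(\<lambda>n. (1 - q ^ n) * ?U z n) \<longlonglongrightarrow> 0" by simp
  next
    fix n
    define x where "x = q ^ n"
    \<comment> \<open>\<open>V\<close> is a common factor of the terms at z and z q and of the next
      term of the certificate; what remains is a polynomial identity in a, z and x.\<close>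
    define V where "V = ?c n * q ^ (n choose 2) * z ^ n * qpoch_inf (a * z * q ^ Suc n) q"
    have nz': "1 - q * x \<noteq> 0" using nz[of "Suc n"] by (auto simp: qpoch_Suc x_def)
    have ch: "Suc n choose 2 = n + (n choose 2)"
      using binomial_Suc_Suc[of n 1] by (simp add: numeral_2_eq_2)
    have "qpoch_inf (a * z * x) q = (1 - a * z * x) * qpoch_inf (a * z * q ^ Suc n) q"
      using qpoch_inf_rec[OF q, of "a * z * x"] by (simp add: x_def mult_ac)
    then have 1: "?U z n = (1 - a * z * x) * V"
      by (simp add: qser_def V_def x_def mult_ac)
    have 2: "?U (z * q) n = x * V"
      by (simp add: qser_def V_def x_def mult_ac power_mult_distrib)
    have "(1 - q ^ Suc n) * ?U z (Suc n) = - (1 - a * x) * x * z * V"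
      using nz nz' by (simp add: qser_def V_def ch qpoch_Suc x_def[symmetric] power_add divide_simps)
         (simp add: algebra_simps)
    then show "?U z n - (1 - z) * ?U (z * q) n
        = (1 - q ^ n) * ?U z n - (1 - q ^ Suc n) * ?U z (Suc n)"
      unfolding 1 2 x_def[symmetric] by (simp add: algebra_simps)
  qed simp
  have iter: "suminf (?U z) = qpoch z q N * suminf (?U (z * q ^ N))" for N
  proof (induction N)
    case (Suc N)
    show ?case
      by (subst Suc.IH, subst step[of "z * q ^ N"]) (simp only: qpoch_Suc power_Suc mult_ac)
  qed simp
  have "(\<lambda>N. qpoch z q N * suminf (?U (z * q ^ N))) \<longlonglongrightarrow> qpoch_inf z q * 1"
    by (intro tendsto_intros qpoch_LIMSEQ q suminf_qser_tendsto[OF q c]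
        tendsto_mult_right_zero LIMSEQ_power_zero) simp
  then show "suminf (?U z) = qpoch_inf z q"
    unfolding iter[symmetric] by (simp add: LIMSEQ_const_iff)
qed

text \<open>Andrews' q-analogue of Bailey's 2F1(1/2) sum, through H(b) = (1 - a b)(1 - a' b) H(b
  q^2). Relating the parameters by a a' = q avoids a division by a.\<close>

lemma suminf_q_bailey:
  assumes q: "norm q < 1" and aa: "a * a' = q"
  shows "summable (qser (\<lambda>n. qpoch a q n * qpoch a' q n / qpoch (q\<^sup>2) (q\<^sup>2) n) 1 q b)" (is "summable (?T b)")
    and "(\<Sum>n. qser (\<lambda>n. qpoch a q n * qpoch a' q n / qpoch (q\<^sup>2) (q\<^sup>2) n) 1 q b n)
      = qpoch_inf (a * b) (q\<^sup>2) * qpoch_inf (a' * b) (q\<^sup>2)"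
proof -
  let ?c = "\<lambda>n. qpoch a q n * qpoch a' q n / qpoch (q\<^sup>2) (q\<^sup>2) n"
  have q2: "norm (q\<^sup>2) < 1" by (rule norm_power_less_1[OF q]) simp
  obtain A where A: "\<And>n. norm (qpoch a q n) \<le> A" using qpoch_bounded[OF q] by metis
  obtain A' where A': "\<And>n. norm (qpoch a' q n) \<le> A'" using qpoch_bounded[OF q] by metis
  obtain B where B: "\<And>n. norm (inverse (qpoch (q\<^sup>2) (q\<^sup>2) n)) \<le> B"
    using inverse_qpoch_bounded[OF q2 q2] by metis
  have c: "norm (?c n) \<le> A * A' * B" for n
    using norm_mult_le_mult[OF norm_mult_le_mult[OF A[of n] A'[of n]] B[of n]]
    by (simp add: divide_inverse)
  note T = summable_qser[OF q c]
  show "summable (?T b)" by (rule T)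
  have nz: "qpoch (q\<^sup>2) (q\<^sup>2) n \<noteq> 0" for n by (rule qpoch_nonzero[OF q2 q2])
  have step: "suminf (?T b) = ((1 - a * b) * (1 - a' * b)) * suminf (?T (b * q\<^sup>2))" for b
  proof -
    \<comment> \<open>The argument is shifted by q^2, so two factors have to be split off the tail
      to reach a common factor.\<close>
    define W where "W n = ?c n * q ^ (n choose 2) * b ^ n * qpoch_inf (b * q ^ (n + 2)) q" for n
    have 1: "?T b n = (1 - b * q ^ n) * (1 - b * q ^ Suc n) * W n" for n
      using qpoch_inf_rec[OF q, of "b * q ^ n"] qpoch_inf_rec[OF q, of "b * q ^ Suc n"]
      by (simp add: qser_def W_def mult_ac)
    have 2: "?T (b * q\<^sup>2) n = (q ^ n)\<^sup>2 * W n" for n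
      by (simp add: qser_def W_def mult_ac power_mult_distrib power2_eq_square)
    show ?thesis
    proof (rule suminf_telescope_eq[OF T T, where G = "\<lambda>n. (1 - (q ^ n)\<^sup>2) * (1 - b * q ^ Suc n) * W n"])
      \<comment> \<open>The certificate lacks the factor \<open>1 - b * q ^ n\<close> of
        \<open>?T b n\<close>, so its decay is not read off from the summability of
        \<open>?T b\<close>; \<open>W\<close> is bounded directly instead.\<close>
      obtain R where R: "\<And>n. norm (qpoch_inf (b * q ^ n) q) \<le> R"
        using convergent_imp_Bseq[OF convergentI[OF qpoch_inf_tendsto_1[OF q
            tendsto_mult_right_zero[OF LIMSEQ_power_zero[OF q], of b]]]] by (metis BseqE)
      have "W \<longlonglongrightarrow> 0"
      proof (rule Lim_null_comparison)
        have "norm (?c n * q ^ (n choose 2) * b ^ n * qpoch_inf (b * q ^ (n + 2)) q)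
           \<le> (A * A' * B) * norm q ^ (n choose 2) * norm b ^ n * R" for n
          unfolding norm_mult[of _ "_ ^ _"] norm_mult[of _ "qpoch_inf _ _"] norm_power
          using c[of n] order_trans[OF norm_ge_zero c[of n]]
          by (intro mult_mono R) auto
        then show "\<forall>\<^sub>F n in sequentially. norm (W n) \<le> (A * A' * B * R) * (norm q ^ (n choose 2) * norm b ^ n)"
          unfolding W_def by (intro always_eventually allI) (simp add: mult_ac)
        show "(\<lambda>n. (A * A' * B * R) * (norm q ^ (n choose 2) * norm b ^ n)) \<longlonglongrightarrow> 0"
          by (intro summable_LIMSEQ_zero summable_mult summable_power_choose_2) (use q in auto)
      qed
      then have "(\<lambda>n. (1 - (q ^ n)\<^sup>2) * (1 - b * q ^ Suc n) * W n) \<longlonglongrightarrow> (1 - 0\<^sup>2) * (1 - b * 0) * 0"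
        by (intro tendsto_intros LIMSEQ_power_zero q LIMSEQ_Suc)
      then show "(\<lambda>n. (1 - (q ^ n)\<^sup>2) * (1 - b * q ^ Suc n) * W n) \<longlonglongrightarrow> 0" by simp
    next
      fix n
      define x where "x = q ^ n"
      have nz': "1 - (q * x)\<^sup>2 \<noteq> 0"
        using nz[of "Suc n"] by (auto simp: qpoch_Suc x_def power_mult_distrib simp flip: power_mult)
           (simp add: mult.commute)
      have ch: "Suc n choose 2 = n + (n choose 2)"
        using binomial_Suc_Suc[of n 1] by (simp add: numeral_2_eq_2)
      have tail: "qpoch_inf (b * q ^ (n + 2)) q = (1 - b * q\<^sup>2 * x) * qpoch_inf (b * q ^ (Suc n + 2)) q"
        using qpoch_inf_rec[OF q, of "b * q ^ (n + 2)"] by (simp add: x_def mult_ac power2_eq_square)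
      have den: "qpoch (q\<^sup>2) (q\<^sup>2) (Suc n) = qpoch (q\<^sup>2) (q\<^sup>2) n * (1 - (q * x)\<^sup>2)"
        by (simp add: qpoch_Suc x_def power_mult_distrib power_even_eq mult.commute flip: power_mult)
      have G: "(1 - (q ^ Suc n)\<^sup>2) * (1 - b * q ^ Suc (Suc n)) * W (Suc n)
          = ((1 - a * x) * (1 - a' * x)) * x * b * W n"
        using nz nz' unfolding W_def tail den ch
        by (simp add: qpoch_Suc x_def[symmetric] power_add power2_eq_square[of q] divide_simps)
      have "?T b n - ((1 - a * b) * (1 - a' * b)) * ?T (b * q\<^sup>2) n
          = ((1 - b * x) * (1 - b * (q * x)) - ((1 - a * b) * (1 - a' * b)) * x\<^sup>2) * W n"
        unfolding 1 2 by (simp add: x_def algebra_simps)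
      \<comment> \<open>The polynomial identity behind the telescoping; it rests on a a' =
        q.\<close>
      also have "(1 - b * x) * (1 - b * (q * x)) - ((1 - a * b) * (1 - a' * b)) * x\<^sup>2
          = (1 - x\<^sup>2) * (1 - b * (q * x)) - ((1 - a * x) * (1 - a' * x)) * x * b"
        unfolding aa[symmetric] by (simp add: algebra_simps power2_eq_square)
      also have "\<dots> * W n = (1 - x\<^sup>2) * (1 - b * (q * x)) * W n - ((1 - a * x) * (1 - a' * x)) * x * b * W n"
        by (rule left_diff_distrib)
      finally show "?T b n - ((1 - a * b) * (1 - a' * b)) * ?T (b * q\<^sup>2) n
         = (1 - (q ^ n)\<^sup>2) * (1 - b * q ^ Suc n) * W n
           - (1 - (q ^ Suc n)\<^sup>2) * (1 - b * q ^ Suc (Suc n)) * W (Suc n)"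
        unfolding G[symmetric] by (simp only: x_def power_Suc)
    qed simp
  qed
  have iter: "suminf (?T b) = (qpoch (a * b) (q\<^sup>2) N * qpoch (a' * b) (q\<^sup>2) N) * suminf (?T (b * (q\<^sup>2) ^ N))" for N
  proof (induction N)
    case (Suc N)
    show ?case
      by (subst Suc.IH, subst step[of "b * (q\<^sup>2) ^ N"]) (simp only: qpoch_Suc power_Suc mult_ac)
  qed simp
  have "(\<lambda>N. (qpoch (a * b) (q\<^sup>2) N * qpoch (a' * b) (q\<^sup>2) N) * suminf (?T (b * (q\<^sup>2) ^ N)))
     \<longlonglongrightarrow> (qpoch_inf (a * b) (q\<^sup>2) * qpoch_inf (a' * b) (q\<^sup>2)) * 1"
    by (intro tendsto_intros qpoch_LIMSEQ q2 suminf_qser_tendsto[OF q c]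
        tendsto_mult_right_zero LIMSEQ_power_zero) simp
  then show "suminf (?T b) = qpoch_inf (a * b) (q\<^sup>2) * qpoch_inf (a' * b) (q\<^sup>2)"
    unfolding iter[symmetric] by (simp add: LIMSEQ_const_iff)
qed

text \<open>Dividing by \<open>qpoch_inf (a * z) q\<close>, nonzero as |a z| < 1, turns each tail
  back into the finite denominator \<open>qpoch (a * z) q n\<close>.\<close>

corollary limit_q_gauss_sums:
  assumes q: "norm q < 1" and az: "norm (a * z) < 1"
  shows "(\<lambda>n. (-1) ^ n * qpoch a q n * q ^ (n choose 2) * z ^ n / (qpoch q q n * qpoch (a * z) q n))
    sums (qpoch_inf z q / qpoch_inf (a * z) q)"
proof -
  have "qser (\<lambda>n. (-1) ^ n * qpoch a q n / qpoch q q n) a q z n / qpoch_inf (a * z) q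
      = (-1) ^ n * qpoch a q n * q ^ (n choose 2) * z ^ n / (qpoch q q n * qpoch (a * z) q n)" for n
    using qpoch_inf_nonzero[OF q az] qpoch_inf_split[OF q, of "a * z" n]
    by (auto simp: qser_def field_simps)
  then show ?thesis
    using sums_divide[OF summable_sums[OF suminf_limit_q_gauss(1)[OF q]], of a z "qpoch_inf (a * z) q"]
    by (simp add: suminf_limit_q_gauss(2)[OF q])
qed

corollary q_bailey_sums:
  assumes q: "norm q < 1" and aa: "a * a' = q" and b: "norm b < 1"
  shows "(\<lambda>n. qpoch a q n * qpoch a' q n * q ^ (n choose 2) * b ^ n / (qpoch (q\<^sup>2) (q\<^sup>2) n * qpoch b q n))
    sums (qpoch_inf (a * b) (q\<^sup>2) * qpoch_inf (a' * b) (q\<^sup>2) / qpoch_inf b q)"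
proof -
  have "qser (\<lambda>n. qpoch a q n * qpoch a' q n / qpoch (q\<^sup>2) (q\<^sup>2) n) 1 q b n / qpoch_inf b q
      = qpoch a q n * qpoch a' q n * q ^ (n choose 2) * b ^ n / (qpoch (q\<^sup>2) (q\<^sup>2) n * qpoch b q n)" for n
    using qpoch_inf_nonzero[OF q b] qpoch_inf_split[OF q, of b n]
    by (auto simp: qser_def field_simps)
  then show ?thesis
    using sums_divide[OF summable_sums[OF suminf_q_bailey(1)[OF q aa]], of b "qpoch_inf b q"]
    by (simp add: suminf_q_bailey(2)[OF q aa])
qed

subsection \<open>A Bailey pair and a theta series\<close>

text \<open>Halving the term at 0 folds a bilateral sum with symmetric terms; the last assumption is
  what makes the certificate compatible with the fold.\<close>

lemma folded_telescope:
  fixes f G :: "nat \<Rightarrow> complex"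
  assumes "\<And>r. r \<le> m \<Longrightarrow> f r = G (Suc r) - G r" "G (Suc m) = 0" "G 0 + G 1 = 0"
  shows "(\<Sum>r\<le>m. if r = 0 then f r / 2 else f r) = 0"
proof -
  have "(\<Sum>r\<le>m. if r = 0 then f r / 2 else f r) = (\<Sum>r\<le>m. f r - (if r = 0 then f r / 2 else 0))"
    by (intro sum.cong) auto
  also have "\<dots> = (\<Sum>r\<le>m. f r) - f 0 / 2"
    by (simp add: sum_subtractf)
  also have "(\<Sum>r\<le>m. f r) = (\<Sum>r\<le>m. G (Suc r) - G r)"
    by (intro sum.cong) (auto simp: assms(1))
  also have "\<dots> = - G 0"
    using sum_lessThan_telescope[of G "Suc m"] assms(2) by (simp add: lessThan_Suc_atMost)
  also have "f 0 = G 1 - G 0" using assms(1)[of 0] by simp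
  finally show ?thesis using assms(3) by (simp add: field_simps add_eq_0_iff)
qed

lemma eq_mult_inverse_mult:
  fixes k S B Q :: complex
  assumes "k * S = B * inverse Q" "Q * k \<noteq> 0"
  shows "S = B * inverse (Q * k)"
  using assms by (simp add: field_simps)

text \<open>The kernel of Bailey pairs relative to 1 in base p. The value 0 for r > n follows the
  convention 1/(p;p)_{-k} = 0 for k > 0, which truncated subtraction would spoil.\<close>

definition bailey_kernel :: "complex \<Rightarrow> nat \<Rightarrow> nat \<Rightarrow> complex" where
  "bailey_kernel p n r = (if r \<le> n then inverse (qpoch p p (n - r) * qpoch p p (n + r)) else 0)"

text \<open>This is \<open>1 / ((p;p)\<^bsub>n+1-r\<^esub> (p;p)\<^bsub>n+r\<^esub>)\<close>, the factor carried by the WZ certificates.\<close>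

definition bailey_kernel_half :: "complex \<Rightarrow> nat \<Rightarrow> nat \<Rightarrow> complex" where
  "bailey_kernel_half p n r = (1 - p ^ (Suc n + r)) * bailey_kernel p (Suc n) r"

text \<open>Everything is expressed through \<open>bailey_kernel p (Suc n) r\<close>, so that the
  certificate identities become polynomial. The edge r = n + 1 is included: there
  \<open>1 - p ^ 0\<close> vanishes together with the left-hand sides.\<close>

lemma bailey_kernel_rec:
  assumes p: "norm p < 1" and "r \<le> Suc n"
  shows "bailey_kernel p n r = (1 - p ^ (Suc n - r)) * (1 - p ^ (Suc n + r)) * bailey_kernel p (Suc n) r"
    and "bailey_kernel_half p n (Suc r) = (1 - p ^ (Suc n - r)) * bailey_kernel p (Suc n) r"
proof -
  have nz: "qpoch p p k \<noteq> 0" for k by (rule qpoch_nonzero[OF p p])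
  have nz': "1 - p * p ^ k \<noteq> 0" for k using nz[of "Suc k"] by (auto simp: qpoch_Suc)
  show "bailey_kernel p n r = (1 - p ^ (Suc n - r)) * (1 - p ^ (Suc n + r)) * bailey_kernel p (Suc n) r"
  proof (cases "r = Suc n")
    case False
    then have "Suc n - r = Suc (n - r)" "r \<le> n" using assms by auto
    then show ?thesis using nz nz' nz'[of "n - r"] nz'[of "n + r"]
      by (simp add: bailey_kernel_def qpoch_Suc divide_simps)
  qed (simp add: bailey_kernel_def)
  show "bailey_kernel_half p n (Suc r) = (1 - p ^ (Suc n - r)) * bailey_kernel p (Suc n) r"
  proof (cases "r = Suc n")
    case False
    then have "Suc n - r = Suc (n - r)" "r \<le> n" using assms by auto
    then show ?thesis using nz nz' nz'[of "Suc (n + r)"]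
      by (simp add: bailey_kernel_def bailey_kernel_half_def qpoch_Suc divide_simps)
  qed (simp add: bailey_kernel_def bailey_kernel_half_def)
qed

text \<open>An instance of the symmetry of 1/((p;p)_{n+1-r} (p;p)_{n+r}) under r -> 1 - r; it gives
  the condition \<open>G 0 + G 1 = 0\<close> for folding.\<close>

lemma bailey_kernel_half_1:
  assumes "norm p < 1"
  shows "bailey_kernel_half p n (Suc 0) = bailey_kernel_half p n 0"
  using bailey_kernel_rec(2)[OF assms, of 0 n] by (simp add: bailey_kernel_half_def[of _ _ 0])

lemma sum_bailey_kernel_Suc:
  "(\<Sum>r\<le>Suc n. c r * bailey_kernel p n r) = (\<Sum>r\<le>n. c r * bailey_kernel p n r)"
  by (simp add: bailey_kernel_def)

text \<open>The terms r and -r of the bilateral family q^(r(2r-1)), merged. With 1/(q;q)_{2n} it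
  forms a Bailey pair relative to 1 in base q^2.\<close>

definition pair_coeff :: "complex \<Rightarrow> nat \<Rightarrow> complex" where
  "pair_coeff q r = (if r = 0 then 1 else q ^ (r * (2 * r - 1)) * (1 + q ^ (2 * r)))"

definition theta_coeff :: "complex \<Rightarrow> nat \<Rightarrow> complex" where
  "theta_coeff q r = (if r = 0 then 1 else 2 * q ^ r\<^sup>2)"

text \<open>Induction on n: the right-hand side obeys a first-order recurrence with factor (1 -
  q^(2n+1))(1 - q^(2n+2)), and the WZ certificate \<open>G\<close> shows that the sum obeys it
  too.\<close>

lemma sum_pair_coeff:
  assumes q: "norm q < 1"
  shows "(\<Sum>r\<le>n. pair_coeff q r * bailey_kernel (q\<^sup>2) n r) = inverse (qpoch q q (2 * n))"
proof (induction n)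
  case 0
  then show ?case by (simp add: pair_coeff_def bailey_kernel_def)
next
  case (Suc n)
  let ?p = "q\<^sup>2"
  have p: "norm ?p < 1" by (rule norm_power_less_1[OF q]) simp
  define A where "A = q ^ (2 * n)"
  \<comment> \<open>At r = 0 the factor \<open>1 + q ^ (2 * r)\<close> is 2, so the halving in the
    fold restores \<open>pair_coeff q 0 = 1\<close>.\<close>
  define f where "f r = q ^ (r * (2 * r - 1)) * (1 + q ^ (2 * r)) *
    ((1 - q * A) * (1 - q\<^sup>2 * A) * bailey_kernel ?p (Suc n) r - bailey_kernel ?p n r)" for r
  define G where "G r = q ^ (r * (2 * r - 1)) * (q * A - q ^ (2 * (Suc n - r))) * bailey_kernel_half ?p n r" for r
  have "(\<Sum>r\<le>Suc n. if r = 0 then f r / 2 else f r) = 0"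
  proof (rule folded_telescope)
    show "G (Suc (Suc n)) = 0"
      by (simp add: G_def bailey_kernel_half_def bailey_kernel_def)
    show "G 0 + G 1 = 0"
      by (simp add: G_def bailey_kernel_half_1[OF p] A_def) (simp add: algebra_simps power2_eq_square)
    fix r assume r: "r \<le> Suc n"
    define v where "v = q ^ (r * (2 * r - 1))"
    define y where "y = q ^ r"
    define E where "E = bailey_kernel ?p (Suc n) r"
    have v': "q ^ (Suc r * (2 * Suc r - 1)) = q * v * y ^ 4"
    proof -
      have "Suc r * (2 * Suc r - 1) = 1 + r * (2 * r - 1) + r * 4"
        by (cases r) (simp_all add: algebra_simps)
      then show ?thesis by (simp only: v_def y_def power_add power_mult power_one_right)
    qed
    have yy: "q ^ (2 * r) = y\<^sup>2" by (simp add: y_def mult.commute flip: power_mult)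
    have py: "?p ^ (Suc n + r) = q\<^sup>2 * A * y\<^sup>2"
      by (simp add: A_def y_def power_add power_mult mult.commute flip: power_mult)
    show "f r = G (Suc r) - G r"
    \<comment> \<open>For r <= n, setting x = q^(2(n-r)) gives A = x y^2 and a polynomial identity.
      At r = n + 1 that exponent would be negative; there \<open>bailey_kernel ?p n r\<close> and
      \<open>G (Suc r)\<close> vanish.\<close>
    proof (cases "r = Suc n")
      case True
      have "y\<^sup>2 = q\<^sup>2 * A" using True yy by (simp add: A_def power2_eq_square mult_ac)
      have "f r = v * (1 + y\<^sup>2) * ((1 - q * A) * (1 - y\<^sup>2) * E)"
        unfolding f_def yy v_def[symmetric] E_def \<open>y\<^sup>2 = q\<^sup>2 * A\<close>
        by (simp add: True bailey_kernel_def)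
      moreover have "G r = v * (q * A - 1) * ((1 - y\<^sup>2 * y\<^sup>2) * E)"
        unfolding G_def bailey_kernel_half_def py v_def[symmetric] E_def \<open>y\<^sup>2 = q\<^sup>2 * A\<close>
        by (simp add: True)
      moreover have "G (Suc r) = 0"
        using True by (simp add: G_def bailey_kernel_half_def bailey_kernel_def)
      ultimately show ?thesis by algebra
    next
      case False
      then have rn: "r \<le> n" using r by simp
      define x where "x = q ^ (2 * (n - r))"
      have x: "q ^ (2 * (Suc n - r)) = q\<^sup>2 * x" "?p ^ (Suc n - r) = q\<^sup>2 * x"
        using rn by (simp_all add: x_def Suc_diff_le power_mult power2_eq_square)
      have A: "A = x * y\<^sup>2"
        using rn unfolding A_def x_def yy[symmetric] power_add[symmetric] by (simp flip: mult_2 distrib_left)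
      have "f r = v * (1 + y\<^sup>2) * ((1 - q * A) * (1 - q\<^sup>2 * A) * E - (1 - q\<^sup>2 * x) * (1 - q\<^sup>2 * A * y\<^sup>2) * E)"
        unfolding f_def bailey_kernel_rec(1)[OF p r] x py v_def[symmetric] yy E_def ..
      moreover have "G r = v * (q * A - q\<^sup>2 * x) * ((1 - q\<^sup>2 * A * y\<^sup>2) * E)"
        unfolding G_def bailey_kernel_half_def x py v_def[symmetric] E_def ..
      moreover have "G (Suc r) = q * v * y ^ 4 * (q * A - x) * ((1 - q\<^sup>2 * x) * E)"
        unfolding G_def bailey_kernel_rec(2)[OF p r] x v' E_def by (simp add: x_def)
      ultimately show ?thesis unfolding A by algebra
    qed
  qed
  also have "(\<Sum>r\<le>Suc n. if r = 0 then f r / 2 else f r)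
      = (\<Sum>r\<le>Suc n. (1 - q * A) * (1 - q\<^sup>2 * A) * (pair_coeff q r * bailey_kernel ?p (Suc n) r)
          - pair_coeff q r * bailey_kernel ?p n r)"
    by (intro sum.cong refl) (simp add: f_def pair_coeff_def right_diff_distrib diff_divide_distrib mult_ac)
  also have "\<dots> = (1 - q * A) * (1 - q\<^sup>2 * A) * (\<Sum>r\<le>Suc n. pair_coeff q r * bailey_kernel ?p (Suc n) r)
      - inverse (qpoch q q (2 * n))"
    unfolding sum_subtractf sum_distrib_left[symmetric] sum_bailey_kernel_Suc Suc.IH ..
  finally have *: "(1 - q * A) * (1 - q\<^sup>2 * A) * (\<Sum>r\<le>Suc n. pair_coeff q r * bailey_kernel ?p (Suc n) r)
      = inverse (qpoch q q (2 * n))" by simp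
  have **: "qpoch q q (2 * Suc n) = qpoch q q (2 * n) * ((1 - q * A) * (1 - q\<^sup>2 * A))"
    by (simp add: qpoch_Suc A_def power2_eq_square mult_ac)
  have "qpoch q q (2 * Suc n) \<noteq> 0" by (rule qpoch_nonzero[OF q q])
  then show ?case
    using eq_mult_inverse_mult[of "(1 - q * A) * (1 - q\<^sup>2 * A)" _ 1] * unfolding ** by simp
qed

text \<open>The finite Jacobi triple product at argument 1: the sum of q^(r^2) times the Gaussian
  binomial [2n, n+r] in base q^2 over -n <= r <= n, divided by (q^2;q^2)_{2n}. The WZ scheme is that
  of \<open>sum_pair_coeff\<close>.\<close>

lemma sum_theta_coeff:
  assumes q: "norm q < 1"
  shows "(\<Sum>r\<le>n. theta_coeff q r * bailey_kernel (q\<^sup>2) n r)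
    = (qpoch (- q) (q\<^sup>2) n)\<^sup>2 * inverse (qpoch (q\<^sup>2) (q\<^sup>2) (2 * n))"
proof (induction n)
  case 0
  then show ?case by (simp add: theta_coeff_def bailey_kernel_def)
next
  case (Suc n)
  let ?p = "q\<^sup>2"
  have p: "norm ?p < 1" by (rule norm_power_less_1[OF q]) simp
  define A where "A = q ^ (2 * n)"
  define f where "f r = 2 * q ^ r\<^sup>2 *
    ((1 - q\<^sup>2 * A\<^sup>2) * (1 - q ^ 4 * A\<^sup>2) * bailey_kernel ?p (Suc n) r - (1 + q * A)\<^sup>2 * bailey_kernel ?p n r)" for r
  define G where "G r = 2 * (1 + q * A) * q ^ r\<^sup>2 * (q * A - q ^ (2 * (Suc n - r))) * bailey_kernel_half ?p n r" for r
  have "(\<Sum>r\<le>Suc n. if r = 0 then f r / 2 else f r) = 0"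
  proof (rule folded_telescope)
    show "G (Suc (Suc n)) = 0"
      by (simp add: G_def bailey_kernel_half_def bailey_kernel_def)
    show "G 0 + G 1 = 0"
      by (simp add: G_def bailey_kernel_half_1[OF p] A_def) (simp add: algebra_simps power2_eq_square)
    fix r assume r: "r \<le> Suc n"
    define v where "v = q ^ r\<^sup>2"
    define y where "y = q ^ r"
    define E where "E = bailey_kernel ?p (Suc n) r"
    have v': "q ^ (Suc r)\<^sup>2 = q * v * y\<^sup>2"
    proof -
      have "(Suc r)\<^sup>2 = 1 + r\<^sup>2 + r * 2"
        by (simp add: power2_eq_square)
      then show ?thesis by (simp only: v_def y_def power_add power_mult power_one_right)
    qed
    have yy: "q ^ (2 * r) = y\<^sup>2" by (simp add: y_def mult.commute flip: power_mult)
    have py: "?p ^ (Suc n + r) = q\<^sup>2 * A * y\<^sup>2"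
      by (simp add: A_def y_def power_add power_mult mult.commute flip: power_mult)
    show "f r = G (Suc r) - G r"
    proof (cases "r = Suc n")
      case True
      have "y\<^sup>2 = q\<^sup>2 * A" using True yy by (simp add: A_def power2_eq_square mult_ac)
      have "f r = 2 * v * ((1 - q\<^sup>2 * A\<^sup>2) * (1 - q ^ 4 * A\<^sup>2) * E)"
        using True by (simp add: f_def v_def E_def bailey_kernel_def)
      moreover have "G r = 2 * (1 + q * A) * v * (q * A - 1) * ((1 - (q\<^sup>2 * A) * (q\<^sup>2 * A)) * E)"
        unfolding G_def bailey_kernel_half_def py v_def[symmetric] E_def \<open>y\<^sup>2 = q\<^sup>2 * A\<close>
        by (simp add: True)
      moreover have "G (Suc r) = 0"
        using True by (simp add: G_def bailey_kernel_half_def bailey_kernel_def)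
      ultimately show ?thesis by algebra
    next
      case False
      then have rn: "r \<le> n" using r by simp
      define x where "x = q ^ (2 * (n - r))"
      have x: "q ^ (2 * (Suc n - r)) = q\<^sup>2 * x" "?p ^ (Suc n - r) = q\<^sup>2 * x"
        using rn by (simp_all add: x_def Suc_diff_le power_mult power2_eq_square)
      have A: "A = x * y\<^sup>2"
        using rn unfolding A_def x_def yy[symmetric] power_add[symmetric] by (simp flip: mult_2 distrib_left)
      have "f r = 2 * v * ((1 - q\<^sup>2 * A\<^sup>2) * (1 - q ^ 4 * A\<^sup>2) * E - (1 + q * A)\<^sup>2 * ((1 - q\<^sup>2 * x) * (1 - q\<^sup>2 * A * y\<^sup>2) * E))"
        unfolding f_def bailey_kernel_rec(1)[OF p r] x py v_def[symmetric] E_def ..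
      moreover have "G r = 2 * (1 + q * A) * v * (q * A - q\<^sup>2 * x) * ((1 - q\<^sup>2 * A * y\<^sup>2) * E)"
        unfolding G_def bailey_kernel_half_def x py v_def[symmetric] E_def ..
      moreover have "G (Suc r) = 2 * (1 + q * A) * (q * v * y\<^sup>2) * (q * A - x) * ((1 - q\<^sup>2 * x) * E)"
        unfolding G_def bailey_kernel_rec(2)[OF p r] x v' E_def by (simp add: x_def)
      ultimately show ?thesis unfolding A by algebra
    qed
  qed
  also have "(\<Sum>r\<le>Suc n. if r = 0 then f r / 2 else f r)
      = (\<Sum>r\<le>Suc n. (1 - q\<^sup>2 * A\<^sup>2) * (1 - q ^ 4 * A\<^sup>2) * (theta_coeff q r * bailey_kernel ?p (Suc n) r)
          - (1 + q * A)\<^sup>2 * (theta_coeff q r * bailey_kernel ?p n r))"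
    by (intro sum.cong refl) (simp add: f_def theta_coeff_def right_diff_distrib diff_divide_distrib mult_ac)
  also have "\<dots> = (1 - q\<^sup>2 * A\<^sup>2) * (1 - q ^ 4 * A\<^sup>2) * (\<Sum>r\<le>Suc n. theta_coeff q r * bailey_kernel ?p (Suc n) r)
      - (1 + q * A)\<^sup>2 * ((qpoch (- q) ?p n)\<^sup>2 * inverse (qpoch ?p ?p (2 * n)))"
    unfolding sum_subtractf sum_distrib_left[symmetric] sum_bailey_kernel_Suc Suc.IH ..
  finally have *: "(1 - q\<^sup>2 * A\<^sup>2) * (1 - q ^ 4 * A\<^sup>2) * (\<Sum>r\<le>Suc n. theta_coeff q r * bailey_kernel ?p (Suc n) r)
      = (1 + q * A)\<^sup>2 * ((qpoch (- q) ?p n)\<^sup>2 * inverse (qpoch ?p ?p (2 * n)))" by simp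
  have **: "qpoch ?p ?p (2 * Suc n) = qpoch ?p ?p (2 * n) * ((1 - q\<^sup>2 * A\<^sup>2) * (1 - q ^ 4 * A\<^sup>2))"
  proof -
    have "?p ^ (2 * n) = A\<^sup>2" by (simp add: A_def mult_ac flip: power_mult)
    moreover have "q ^ 4 = q\<^sup>2 * q\<^sup>2" by (simp flip: power_add)
    ultimately show ?thesis by (simp add: qpoch_Suc mult_ac)
  qed
  have ***: "qpoch (- q) ?p (Suc n) = qpoch (- q) ?p n * (1 + q * A)"
    by (simp add: qpoch_Suc A_def power_mult)
  have "qpoch ?p ?p (2 * Suc n) \<noteq> 0" by (rule qpoch_nonzero[OF p p])
  then show ?case
    using eq_mult_inverse_mult[OF *[folded mult.assoc]] unfolding ** *** by (simp add: power_mult_distrib mult_ac)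
qed

section \<open>From the finite identities to the theta series\<close>

lemma norm_bailey_kernel_le:
  assumes "\<And>k. norm (inverse (qpoch p p k)) \<le> C"
  shows "norm (bailey_kernel p n r) \<le> C * C"
proof -
  have "0 \<le> C * C" by simp
  then show ?thesis
    using norm_mult_le_mult[OF assms assms, of "n - r" "n + r"] by (auto simp: bailey_kernel_def)
qed

lemma bailey_kernel_tendsto:
  assumes p: "norm p < 1"
  shows "(\<lambda>n. bailey_kernel p n r) \<longlonglongrightarrow> inverse (qpoch_inf p p * qpoch_inf p p)"
\<comment> \<open>Shifting n by r keeps the index in the range where the kernel is not set to
  0.\<close>
proof (rule LIMSEQ_offset[of _ r])
  have "(\<lambda>n. qpoch p p (n + 2 * r)) \<longlonglongrightarrow> qpoch_inf p p"
    by (rule LIMSEQ_ignore_initial_segment[OF qpoch_LIMSEQ[OF p]])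
  then have "(\<lambda>n. inverse (qpoch p p n * qpoch p p (n + 2 * r))) \<longlonglongrightarrow> inverse (qpoch_inf p p * qpoch_inf p p)"
    using qpoch_inf_nonzero[OF p p] by (intro tendsto_intros qpoch_LIMSEQ p) auto
  then show "(\<lambda>n. bailey_kernel p (n + r) r) \<longlonglongrightarrow> inverse (qpoch_inf p p * qpoch_inf p p)"
    by (simp add: bailey_kernel_def mult_2 add_ac)
qed

lemma norm_power_le:
  fixes q :: complex
  assumes "norm q < 1" "r \<le> k"
  shows "norm (q ^ k) \<le> norm q ^ r"
  using assms by (simp add: norm_power power_decreasing)

lemma norm_theta_coeff_le:
  assumes "norm q < 1"
  shows "norm (theta_coeff q r) \<le> 2 * norm q ^ r"
  using norm_power_le[OF assms, of r "r\<^sup>2"]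
  by (auto simp: theta_coeff_def norm_mult power2_nat_le_imp_le intro: le_square)

lemma norm_pair_coeff_le:
  assumes "norm q < 1"
  shows "norm (pair_coeff q r) \<le> 2 * norm q ^ r"
proof (cases "r = 0")
  case False
  then have "r \<le> r * (2 * r - 1)" by simp
  from norm_power_le[OF assms this] have "norm (q ^ (r * (2 * r - 1))) \<le> norm q ^ r" .
  moreover have "norm (1 + q ^ (2 * r)) \<le> 2"
    using norm_triangle_ineq[of 1 "q ^ (2 * r)"] norm_power_le[OF assms, of 0 "2 * r"] by simp
  ultimately have "norm (q ^ (r * (2 * r - 1)) * (1 + q ^ (2 * r))) \<le> norm q ^ r * 2"
    by (rule norm_mult_le_mult)
  then show ?thesis using False by (simp add: pair_coeff_def mult.commute)
qed (simp add: pair_coeff_def)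

text \<open>Finite sums over r are read as series with zero tails, the form to which Tannery's
  theorem applies.\<close>

lemma suminf_eq_sum_atMost:
  fixes f :: "nat \<Rightarrow> complex"
  assumes "\<And>r. r > n \<Longrightarrow> f r = 0"
  shows "suminf f = (\<Sum>r\<le>n. f r)"
  using assms by (intro suminf_finite) auto

text \<open>Let n tend to infinity in the finite triple product: with P = (q^2;q^2)_inf each kernel
  tends to 1/P^2 and the right-hand side to (-q;q^2)_inf^2 / P. Tannery's theorem justifies the
  limit, and multiplying by P^2 finishes.\<close>

lemma theta_coeff_sums:
  assumes q: "norm q < 1"
  shows "theta_coeff q sums ((qpoch_inf (- q) (q\<^sup>2))\<^sup>2 * qpoch_inf (q\<^sup>2) (q\<^sup>2))"
proof -
  let ?p = "q\<^sup>2"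
  have p: "norm ?p < 1" by (rule norm_power_less_1[OF q]) simp
  let ?P = "qpoch_inf ?p ?p"
  have P: "?P \<noteq> 0" by (rule qpoch_inf_nonzero[OF p p])
  obtain C where C: "\<And>n. norm (inverse (qpoch ?p ?p n)) \<le> C" using inverse_qpoch_bounded[OF p p] by metis
  let ?a = "\<lambda>r n. theta_coeff q r * bailey_kernel ?p n r"
  have lim: "(\<lambda>n. ?a r n) \<longlonglongrightarrow> theta_coeff q r * inverse (?P * ?P)" for r
    by (intro tendsto_intros bailey_kernel_tendsto p)
  have bound: "norm (?a r n) \<le> 2 * norm q ^ r * (C * C)" for r n
    by (rule norm_mult_le_mult[OF norm_theta_coeff_le[OF q] norm_bailey_kernel_le[OF C]])
  have "summable (\<lambda>r. 2 * norm q ^ r * (C * C))"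
    using q by (intro summable_mult summable_mult2 summable_geometric) simp
  note tannery = tannerys_theorem[OF lim always_eventually this sequentially_bot]
  have "(\<lambda>n. suminf (\<lambda>r. ?a r n)) \<longlonglongrightarrow> (\<Sum>r. theta_coeff q r * inverse (?P * ?P))"
    and sm: "summable (\<lambda>r. norm (theta_coeff q r * inverse (?P * ?P)))"
    using tannery bound by auto
  moreover have "suminf (\<lambda>r. ?a r n) = (qpoch (- q) ?p n)\<^sup>2 * inverse (qpoch ?p ?p (2 * n))" for n
    unfolding sum_theta_coeff[OF q, symmetric]
    by (rule suminf_eq_sum_atMost) (simp add: bailey_kernel_def)
  moreover have "(\<lambda>n. (qpoch (- q) ?p n)\<^sup>2 * inverse (qpoch ?p ?p (2 * n))) \<longlonglongrightarrow> (qpoch_inf (- q) ?p)\<^sup>2 * inverse ?P"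
  proof -
    have "(\<lambda>n. qpoch ?p ?p (2 * n)) \<longlonglongrightarrow> ?P"
      using LIMSEQ_subseq_LIMSEQ[OF qpoch_LIMSEQ[OF p], of "\<lambda>n. 2 * n" ?p]
      by (simp add: strict_mono_def o_def)
    then show ?thesis by (intro tendsto_intros qpoch_LIMSEQ p P)
  qed
  ultimately have "(\<Sum>r. theta_coeff q r * inverse (?P * ?P)) = (qpoch_inf (- q) ?p)\<^sup>2 * inverse ?P"
    by (simp add: LIMSEQ_unique)
  with summable_norm_cancel[OF sm]
  have "(\<lambda>r. theta_coeff q r * inverse (?P * ?P)) sums ((qpoch_inf (- q) ?p)\<^sup>2 * inverse ?P)"
    by (simp add: sums_iff)
  from sums_mult2[OF this, of "?P * ?P"] show ?thesis
    using P by (simp add: field_simps)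
qed

subsection \<open>The four identities\<close>

lemma power_choose_2: "(x\<^sup>2) ^ (n choose 2) * x ^ n = x ^ n\<^sup>2" for x :: complex
proof -
  have "2 * (n choose 2) + n = n\<^sup>2"
    by (cases n) (simp_all add: choose_two power2_eq_square algebra_simps)
  then show ?thesis by (simp flip: power_mult power_add)
qed

text \<open>The limiting q-Gauss sum in base q^2 with a = -q^2 and z = -q, hence a z = q^3, combined
  with (q;q)_{2n+1} = (1 - q)(q^2;q^2)_n (q^3;q^2)_n.\<close>

lemma sums_gauss_type:
  assumes q: "norm q < 1"
  shows "(\<lambda>n. qpoch (-(q^2)) (q^2) n * q^(n^2) / qpoch q q (2*n+1))
    sums (qpoch_inf (-q) (q^2) / qpoch_inf q (q^2))"
proof -
  have p: "norm (q\<^sup>2) < 1" and q3: "norm (q ^ 3) < 1" by (rule norm_power_less_1[OF q]; simp)+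
  have "q * q\<^sup>2 = q ^ 3" by (simp add: eval_nat_numeral)
  have "(-1) ^ n * qpoch (- q\<^sup>2) (q\<^sup>2) n * (q\<^sup>2) ^ (n choose 2) * (- q) ^ n / (qpoch (q\<^sup>2) (q\<^sup>2) n * qpoch (q ^ 3) (q\<^sup>2) n) / (1 - q)
     = qpoch (- q\<^sup>2) (q\<^sup>2) n * q ^ n\<^sup>2 / qpoch q q (2 * n + 1)" for n
  proof -
    have "qpoch q q (2 * n + 1) = (1 - q) * (qpoch (q\<^sup>2) (q\<^sup>2) n * qpoch (q ^ 3) (q\<^sup>2) n)"
      using qpoch_Suc_shift[of q q "2 * n"] \<open>q * q\<^sup>2 = q ^ 3\<close> qpoch_even[of "q * q" q n]
      by (simp add: power2_eq_square mult_ac)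
    moreover have "(-1) ^ n * (- q) ^ n = q ^ n" by (simp flip: power_mult_distrib)
    ultimately show ?thesis by (simp add: mult_ac flip: power_choose_2)
  qed
  moreover have "qpoch_inf q (q\<^sup>2) = (1 - q) * qpoch_inf (q ^ 3) (q\<^sup>2)"
    using qpoch_inf_rec[OF p, of q] \<open>q * q\<^sup>2 = q ^ 3\<close> by simp
  moreover have "- q\<^sup>2 * - q = q ^ 3" by (simp add: eval_nat_numeral)
  ultimately show ?thesis
    using sums_divide[OF limit_q_gauss_sums[OF p, of "- q\<^sup>2" "- q"], of "1 - q"] q3
    by (simp add: mult_ac)
qed

text \<open>Since x^2 = q, the factors at x and -x pair up to (q;q^2)_inf. With base q^4 and x = q^2
  it rewrites (q^8;q^8)_inf (q^2;q^4)_inf / (q^4;q^4)_inf as 1/(-q^2;q^4)_inf.\<close>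

lemma qpoch_inf_euler:
  assumes q: "norm q < 1" and x: "x\<^sup>2 = q"
  shows "qpoch_inf (q\<^sup>2) (q\<^sup>2) * qpoch_inf (- x) q * qpoch_inf x q = qpoch_inf q q"
  using qpoch_inf_mult_neg[OF q, of x] qpoch_inf_even[OF q, of q] x
  by (simp add: power2_eq_square mult_ac)

text \<open>The choice a = q, a' = q^3 in base q^4, where (q;q^4)_n (q^3;q^4)_n =
  (q;q^2)_{2n}.\<close>

lemma q_bailey_sums_base_4:
  assumes q: "norm q < 1" and b: "norm b < 1"
  shows "(\<lambda>n. qpoch q (q\<^sup>2) (2 * n) * (q ^ 4) ^ (n choose 2) * b ^ n / (qpoch (q ^ 8) (q ^ 8) n * qpoch b (q ^ 4) n))
    sums (qpoch_inf (q * b) (q ^ 8) * qpoch_inf (q ^ 3 * b) (q ^ 8) / qpoch_inf b (q ^ 4))"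
proof -
  have "norm (q ^ 4) < 1" by (rule norm_power_less_1[OF q]) simp
  moreover have "q * q ^ 3 = q ^ 4" "q * q\<^sup>2 = q ^ 3" by (simp_all add: eval_nat_numeral)
  moreover have "(q ^ 4)\<^sup>2 = q ^ 8" "(q\<^sup>2)\<^sup>2 = q ^ 4" by (simp_all flip: power_mult)
  ultimately show ?thesis
    using q_bailey_sums[of "q ^ 4" q "q ^ 3" b] b by (simp add: qpoch_even)
qed

lemma base_4_products:
  assumes q: "norm q < 1"
  shows "qpoch_inf_list [x, y, q ^ 8] (q ^ 8) * (qpoch_inf (q\<^sup>2) (q ^ 4) / qpoch_inf (q ^ 4) (q ^ 4))
    = qpoch_inf x (q ^ 8) * qpoch_inf y (q ^ 8) / qpoch_inf (- (q\<^sup>2)) (q ^ 4)"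
proof -
  have q2: "norm (- (q\<^sup>2)) < 1" and q4: "norm (q ^ 4) < 1"
    using norm_power_less_1[OF q] by simp_all
  have "(q ^ 4)\<^sup>2 = q ^ 8" "(q\<^sup>2)\<^sup>2 = q ^ 4" by (simp_all flip: power_mult)
  then show ?thesis
    using qpoch_inf_euler[OF q4, of "q\<^sup>2"] qpoch_inf_nonzero[OF q4 q2] qpoch_inf_nonzero[OF q4 q4]
    by (simp add: qpoch_inf_list_def divide_simps mult_ac)
qed

text \<open>The case b = -q^2, where 4 (n choose 2) + 2n = 2n^2.\<close>

lemma sums_mod_8_second:
  assumes q: "norm q < 1"
  shows "(\<lambda>n. qpoch q (q^2) (2*n) * q^(2*n^2) * (-1)^n
          / (qpoch (q^8) (q^8) n * qpoch (-(q^2)) (q^4) n))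
       sums (qpoch_inf_list [-(q^3), -(q^5), q^8] (q^8)
             * (qpoch_inf (q^2) (q^4) / qpoch_inf (q^4) (q^4)))"
proof -
  have q2: "norm (- (q\<^sup>2)) < 1" using norm_power_less_1[OF q] by simp
  have "(q ^ 4) ^ (n choose 2) * (- (q\<^sup>2)) ^ n = q ^ (2 * n\<^sup>2) * (-1) ^ n" for n
    using power_choose_2[of "q\<^sup>2" n] by (simp add: power_minus[of "q\<^sup>2"] flip: power_mult)
  then have *: "x * (q ^ 4) ^ (n choose 2) * (- (q\<^sup>2)) ^ n = x * q ^ (2 * n\<^sup>2) * (-1) ^ n" for n x
    by (simp only: mult.assoc)
  have "q * - (q\<^sup>2) = - (q ^ 3)" "q ^ 3 * - (q\<^sup>2) = - (q ^ 5)" by (simp_all add: eval_nat_numeral)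
  then show ?thesis
    using q_bailey_sums_base_4[OF q q2] unfolding * base_4_products[OF q] by simp
qed

text \<open>The case b = -q^6, where 4 (n choose 2) + 6n = 2n^2 + 4n; dividing by 1 + q^2 lengthens
  (-q^6;q^4)_n to (-q^2;q^4)_{n+1}.\<close>

lemma sums_mod_8_first:
  assumes q: "norm q < 1"
  shows "(\<lambda>n. qpoch q (q^2) (2*n) * q^(2*n^2+4*n) * (-1)^n
          / (qpoch (q^8) (q^8) n * qpoch (-(q^2)) (q^4) (n+1)))
       sums (qpoch_inf_list [-(q^9), -(q^7), q^8] (q^8)
             * (qpoch_inf (q^2) (q^4) / qpoch_inf (q^4) (q^4)))"
proof -
  have q6: "norm (- (q ^ 6)) < 1" and q4: "norm (q ^ 4) < 1" using norm_power_less_1[OF q] by simp_all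
  have "(q ^ 4) ^ (n choose 2) * (- (q ^ 6)) ^ n = q ^ (2 * n\<^sup>2 + 4 * n) * (-1) ^ n" for n
  proof -
    have "(- (q ^ 6)) ^ n = (q\<^sup>2) ^ n * q ^ (4 * n) * (-1) ^ n"
      by (simp add: power_minus[of "q ^ 6"] flip: power_mult power_add)
    then show ?thesis
      using power_choose_2[of "q\<^sup>2" n] by (simp add: power_add flip: power_mult)
  qed
  then have *: "x * (q ^ 4) ^ (n choose 2) * (- (q ^ 6)) ^ n = x * q ^ (2 * n\<^sup>2 + 4 * n) * (-1) ^ n" for n x
    by (simp only: mult.assoc)
  have q26: "- (q\<^sup>2) * q ^ 4 = - (q ^ 6)" by (simp flip: power_add)
  have "qpoch (- (q\<^sup>2)) (q ^ 4) (n + 1) = (1 + q\<^sup>2) * qpoch (- (q ^ 6)) (q ^ 4) n" for n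
    using qpoch_Suc_shift[of "- (q\<^sup>2)" "q ^ 4" n] q26 by simp
  moreover have "qpoch_inf (- (q\<^sup>2)) (q ^ 4) = (1 + q\<^sup>2) * qpoch_inf (- (q ^ 6)) (q ^ 4)"
    using qpoch_inf_rec[OF q4, of "- (q\<^sup>2)"] q26 by simp
  moreover have "q * - (q ^ 6) = - (q ^ 7)" "q ^ 3 * - (q ^ 6) = - (q ^ 9)" by (simp_all flip: power_add power_Suc)
  ultimately show ?thesis
    using sums_divide[OF q_bailey_sums_base_4[OF q q6], of "1 + q\<^sup>2"]
    unfolding * base_4_products[OF q] by (simp add: mult_ac)
qed

text \<open>After the shift n -> n + r this is the limiting q-Gauss sum in base p = q^2 with a =
  -p^r and z = -p^(r+1), hence a z = p^(2r+1). The prefactor \<open>?K\<close> is the term at n =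
  r.\<close>

lemma pair_coeff_inner_sums:
  assumes q: "norm q < 1"
  shows "(\<lambda>n. qpoch (-1) (q\<^sup>2) n * q ^ (n\<^sup>2 + n) * bailey_kernel (q\<^sup>2) n r)
    sums (qpoch (-1) (q\<^sup>2) r * q ^ (r\<^sup>2 + r) * qpoch_inf (- ((q\<^sup>2) ^ Suc r)) (q\<^sup>2) / qpoch_inf (q\<^sup>2) (q\<^sup>2))"
proof -
  let ?p = "q\<^sup>2"
  have p: "norm ?p < 1" by (rule norm_power_less_1[OF q]) simp
  have az: "- (?p ^ r) * - (?p ^ Suc r) = ?p * ?p ^ (2 * r)"
    by (simp add: mult_2_right mult.commute[of 2] power_add mult_ac)
  have "norm (?p ^ Suc (2 * r)) < 1" by (rule norm_power_less_1[OF p]) simp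
  then have az1: "norm (- (?p ^ r) * - (?p ^ Suc r)) < 1" unfolding az by simp
  let ?K = "qpoch (-1) ?p r * q ^ (r\<^sup>2 + r) / qpoch ?p ?p (2 * r)"
  let ?g = "\<lambda>n. (-1) ^ n * qpoch (- (?p ^ r)) ?p n * ?p ^ (n choose 2) * (- (?p ^ Suc r)) ^ n
      / (qpoch ?p ?p n * qpoch (?p * ?p ^ (2 * r)) ?p n)"
  have g: "qpoch (-1) ?p (n + r) * q ^ ((n + r)\<^sup>2 + (n + r)) * bailey_kernel ?p (n + r) r = ?K * ?g n" for n
  proof -
    have "(-1) ^ n * (- (?p ^ Suc r)) ^ n = (?p ^ Suc r) ^ n" by (simp flip: power_mult_distrib)
    also have "\<dots> = q ^ n * q ^ (2 * n * r + n)"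
      by (simp add: algebra_simps flip: power_mult power_add)
    finally have "q ^ (r\<^sup>2 + r) * (?p ^ (n choose 2) * ((-1) ^ n * (- (?p ^ Suc r)) ^ n))
       = q ^ (r\<^sup>2 + r) * q ^ (2 * n * r + n) * (?p ^ (n choose 2) * q ^ n)" by (simp add: mult_ac)
    also have "\<dots> = q ^ ((n + r)\<^sup>2 + (n + r))"
    proof -
      have e: "r\<^sup>2 + r + (2 * n * r + n) + n\<^sup>2 = (n + r)\<^sup>2 + (n + r)"
        by (simp add: power2_eq_square algebra_simps)
      show ?thesis unfolding power_choose_2 by (simp only: e flip: power_add)
    qed
    finally have e: "q ^ ((n + r)\<^sup>2 + (n + r)) = q ^ (r\<^sup>2 + r) * (?p ^ (n choose 2) * ((-1) ^ n * (- (?p ^ Suc r)) ^ n))" ..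
    have k: "bailey_kernel ?p (n + r) r = inverse (qpoch ?p ?p n * (qpoch ?p ?p (2 * r) * qpoch (?p * ?p ^ (2 * r)) ?p n))"
      using qpoch_add[of ?p ?p "2 * r" n] by (simp add: bailey_kernel_def mult_2 add_ac)
    have b: "qpoch (-1) ?p (n + r) = qpoch (-1) ?p r * qpoch (- (?p ^ r)) ?p n"
      using qpoch_add[of "-1" ?p r n] by (simp add: add_ac)
    show ?thesis unfolding e k b by (simp add: divide_inverse mult_ac)
  qed
  have "(\<lambda>n. ?K * ?g n) sums (?K * (qpoch_inf (- (?p ^ Suc r)) ?p / qpoch_inf (?p * ?p ^ (2 * r)) ?p))"
    using limit_q_gauss_sums[OF p az1] unfolding az by (rule sums_mult)
  also have "?K * (qpoch_inf (- (?p ^ Suc r)) ?p / qpoch_inf (?p * ?p ^ (2 * r)) ?p)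
     = qpoch (-1) ?p r * q ^ (r\<^sup>2 + r) * qpoch_inf (- (?p ^ Suc r)) ?p / qpoch_inf ?p ?p"
    by (simp add: qpoch_inf_split[OF p, of ?p "2 * r"])
  finally have "(\<lambda>n. qpoch (-1) ?p (n + r) * q ^ ((n + r)\<^sup>2 + (n + r)) * bailey_kernel ?p (n + r) r)
     sums (qpoch (-1) ?p r * q ^ (r\<^sup>2 + r) * qpoch_inf (- (?p ^ Suc r)) ?p / qpoch_inf ?p ?p)"
    unfolding g .
  \<comment> \<open>The terms with n < r vanish with the kernel, so the shift loses nothing.\<close>
  then show ?thesis
    by (subst (asm) sums_zero_iff_shift) (simp_all add: bailey_kernel_def)
qed

text \<open>The exponents add up to 3r^2, and the factor 1 + q^(2r) of \<open>pair_coeff\<close>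
  fills the gap between the finite and the infinite product, giving (-1;q^2)_inf = 2 (-q^2;q^2)_inf.
  Hence the theta series of q^3.\<close>

lemma pair_coeff_inner_value:
  assumes q: "norm q < 1"
  shows "pair_coeff q r * (qpoch (-1) (q\<^sup>2) r * q ^ (r\<^sup>2 + r) * qpoch_inf (- ((q\<^sup>2) ^ Suc r)) (q\<^sup>2) / qpoch_inf (q\<^sup>2) (q\<^sup>2))
    = theta_coeff (q ^ 3) r * (qpoch_inf (- (q\<^sup>2)) (q\<^sup>2) / qpoch_inf (q\<^sup>2) (q\<^sup>2))"
proof (cases "r = 0")
  case False
  let ?p = "q\<^sup>2"
  have p: "norm ?p < 1" by (rule norm_power_less_1[OF q]) simp
  have e: "r * (2 * r - 1) + (r\<^sup>2 + r) = 3 * r\<^sup>2"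
    using False by (cases r) (simp_all add: power2_eq_square algebra_simps)
  have "q ^ (r * (2 * r - 1)) * q ^ (r\<^sup>2 + r) = (q ^ 3) ^ r\<^sup>2"
    by (simp only: e flip: power_mult power_add)
  moreover have "qpoch (-1) ?p r * (1 + ?p ^ r) * qpoch_inf (- (?p ^ Suc r)) ?p = qpoch_inf (-1) ?p"
    using qpoch_inf_split[OF p, of "-1" "Suc r"] by (simp add: qpoch_Suc)
  moreover have "qpoch_inf (-1) ?p = 2 * qpoch_inf (- ?p) ?p"
    using qpoch_inf_rec[OF p, of "-1"] by simp
  ultimately have "q ^ (r * (2 * r - 1)) * q ^ (r\<^sup>2 + r) * (qpoch (-1) ?p r * (1 + ?p ^ r) * qpoch_inf (- (?p ^ Suc r)) ?p)
     = 2 * (q ^ 3) ^ r\<^sup>2 * qpoch_inf (- ?p) ?p" by simp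
  moreover have "pair_coeff q r = q ^ (r * (2 * r - 1)) * (1 + ?p ^ r)"
    using False by (simp add: pair_coeff_def power_mult[of q 2 r])
  ultimately show ?thesis
    using False by (simp add: theta_coeff_def mult_ac)
qed (simp add: pair_coeff_def theta_coeff_def)

text \<open>Only the sum over n is truncated at N, so the exchange of sums is finite; Tannery's
  theorem in r then lets N tend to infinity.\<close>

lemma sums_mod_6:
  assumes q: "norm q < 1"
  shows "(\<lambda>n. qpoch (-1) q (2*n) * q^(n^2+n) / (qpoch (q^2) (q^2) n * qpoch (q^2) (q^4) n))
       sums ((qpoch_inf (-(q^3)) (q^6))^2 * qpoch_inf (q^6) (q^6) * qpoch_inf (-(q^2)) (q^2)
             / qpoch_inf (q^2) (q^2))"
proof -
  let ?p = "q\<^sup>2"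
  have p: "norm ?p < 1" and q3: "norm (q ^ 3) < 1" by (rule norm_power_less_1[OF q]; simp)+
  let ?b = "\<lambda>n. qpoch (-1) ?p n * q ^ (n\<^sup>2 + n)"
  let ?I = "\<lambda>r. qpoch (-1) ?p r * q ^ (r\<^sup>2 + r) * qpoch_inf (- (?p ^ Suc r)) ?p / qpoch_inf ?p ?p"
  let ?a = "\<lambda>r N. pair_coeff q r * (\<Sum>n<N. ?b n * bailey_kernel ?p n r)"
  obtain C where C: "\<And>n. norm (inverse (qpoch ?p ?p n)) \<le> C" using inverse_qpoch_bounded[OF p p] by metis
  obtain D where D: "D > 0" "\<And>n. norm (qpoch (-1) ?p n) \<le> D" using qpoch_bounded[OF p] by metis
  have lim: "(\<lambda>N. ?a r N) \<longlonglongrightarrow> pair_coeff q r * ?I r" for r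
    using pair_coeff_inner_sums[OF q, of r] by (intro tendsto_mult_left) (simp add: sums_def)
  \<comment> \<open>Uniform in N: q^(n^2+n) is dominated by the geometric series, which contributes
    1/(1 - |q|).\<close>
  have bound: "norm (?a r N) \<le> 2 * norm q ^ r * (D * (C * C) / (1 - norm q))" for r N
  proof (rule norm_mult_le_mult[OF norm_pair_coeff_le[OF q]])
    have "norm (\<Sum>n<N. ?b n * bailey_kernel ?p n r) \<le> (\<Sum>n<N. D * norm q ^ n * (C * C))"
      by (intro sum_norm_le norm_mult_le_mult norm_bailey_kernel_le C D norm_power_le q) simp
    also have "\<dots> = D * (C * C) * (\<Sum>n<N. norm q ^ n)"
      by (simp add: sum_distrib_left mult_ac)
    also have "\<dots> \<le> D * (C * C) * (\<Sum>n. norm q ^ n)"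
      using D(1) q by (intro mult_left_mono sum_le_suminf summable_geometric) auto
    finally show "norm (\<Sum>n<N. ?b n * bailey_kernel ?p n r) \<le> D * (C * C) / (1 - norm q)"
      using q by (simp add: suminf_geometric)
  qed
  have "summable (\<lambda>r. 2 * norm q ^ r * (D * (C * C) / (1 - norm q)))"
    using q by (intro summable_mult summable_mult2 summable_geometric) simp
  note tannery = tannerys_theorem[OF lim always_eventually this sequentially_bot]
  have "(\<lambda>N. suminf (\<lambda>r. ?a r N)) \<longlonglongrightarrow> (\<Sum>r. pair_coeff q r * ?I r)"
    using tannery bound by auto
  moreover have "suminf (\<lambda>r. ?a r N) = (\<Sum>n<N. ?b n * inverse (qpoch q q (2 * n)))" for N
  proof -
    have "suminf (\<lambda>r. ?a r N) = (\<Sum>r\<le>N. ?a r N)"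
      by (rule suminf_eq_sum_atMost) (auto simp: bailey_kernel_def intro!: sum.neutral)
    also have "\<dots> = (\<Sum>n<N. ?b n * (\<Sum>r\<le>N. pair_coeff q r * bailey_kernel ?p n r))"
      by (simp add: sum_distrib_left mult_ac sum.swap[of _ "{..N}"])
    also have "\<dots> = (\<Sum>n<N. ?b n * (\<Sum>r\<le>n. pair_coeff q r * bailey_kernel ?p n r))"
      by (intro sum.cong refl arg_cong[of _ _ "(*) _"] sum.mono_neutral_right) (auto simp: bailey_kernel_def)
    finally show ?thesis by (simp add: sum_pair_coeff[OF q])
  qed
  moreover have "(\<Sum>r. pair_coeff q r * ?I r)
     = (qpoch_inf (-(q^3)) (q^6))\<^sup>2 * qpoch_inf (q^6) (q^6) * (qpoch_inf (- ?p) ?p / qpoch_inf ?p ?p)"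
    using sums_unique[OF sums_mult2[OF theta_coeff_sums[OF q3], of "qpoch_inf (- ?p) ?p / qpoch_inf ?p ?p"]]
    unfolding pair_coeff_inner_value[OF q] by (simp flip: power_mult)
  ultimately have "(\<lambda>n. ?b n * inverse (qpoch q q (2 * n))) sums
     ((qpoch_inf (-(q^3)) (q^6))\<^sup>2 * qpoch_inf (q^6) (q^6) * (qpoch_inf (- ?p) ?p / qpoch_inf ?p ?p))"
    by (simp add: sums_def)
  \<comment> \<open>The factor (-q;q^2)_n of (-1;q)_{2n} cancels against that of (q^2;q^4)_n =
    (q;q^2)_n (-q;q^2)_n.\<close>
  moreover have "?b n * inverse (qpoch q q (2 * n))
     = qpoch (-1) q (2*n) * q^(n^2+n) / (qpoch (q^2) (q^2) n * qpoch (q^2) (q^4) n)" for n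
  proof -
    have "norm (- q) < 1" using q by simp
    then have "qpoch (- q) ?p n \<noteq> 0" by (rule qpoch_nonzero[OF p])
    moreover have "qpoch ?p (q ^ 4) n = qpoch q ?p n * qpoch (- q) ?p n"
      using qpoch_mult_neg[of q ?p n] by (simp flip: power_mult)
    moreover have "qpoch q q (2 * n) = qpoch q ?p n * qpoch ?p ?p n"
      using qpoch_even[of q q n] by (simp add: power2_eq_square)
    ultimately show ?thesis
      using qpoch_even[of "-1" q n] by (simp add: field_simps)
  qed
  ultimately show ?thesis by simp
qed

theorem theorem2p1:
  fixes q :: complex
  assumes "norm q < 1"
  shows
    "((\<lambda>n. qpoch (-(q^2)) (q^2) n * q^(n^2) / qpoch q q (2*n+1))
       sums (qpoch_inf (-q) (q^2) / qpoch_inf q (q^2)))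
      \<and> ((\<lambda>n. qpoch (-1) q (2*n) * q^(n^2+n) / (qpoch (q^2) (q^2) n * qpoch (q^2) (q^4) n))
       sums ((qpoch_inf (-(q^3)) (q^6))^2 * qpoch_inf (q^6) (q^6) * qpoch_inf (-(q^2)) (q^2)
             / qpoch_inf (q^2) (q^2)))
      \<and> ((\<lambda>n. qpoch q (q^2) (2*n) * q^(2*n^2+4*n) * (-1)^n
          / (qpoch (q^8) (q^8) n * qpoch (-(q^2)) (q^4) (n+1)))
       sums (qpoch_inf_list [-(q^9), -(q^7), q^8] (q^8)
             * (qpoch_inf (q^2) (q^4) / qpoch_inf (q^4) (q^4))))
      \<and> ((\<lambda>n. qpoch q (q^2) (2*n) * q^(2*n^2) * (-1)^n
          / (qpoch (q^8) (q^8) n * qpoch (-(q^2)) (q^4) n))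
       sums (qpoch_inf_list [-(q^3), -(q^5), q^8] (q^8)
             * (qpoch_inf (q^2) (q^4) / qpoch_inf (q^4) (q^4))))"
  using sums_gauss_type[OF assms] sums_mod_6[OF assms] sums_mod_8_first[OF assms] sums_mod_8_second[OF assms]
  by (intro conjI)

end
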